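(* Assume treatment ignorability, latent principal ignorability and the odds-ratio (non-monotonicity) assumption (all stated in the context), with binary outcomes $Y(z)\in\{0,1\}$. Fix $s\in\{11,10,01,00\}$, and for $z\in\{0,1\}$ let $d_z$ be the value with $s\in\mathcal S_{z,d_z}$. Suppose $m_{1,d_1}(x)-m_{0,d_0}(x)>0$ and $\lim_{\Lambda\to\infty}\{L_{1,s}(x,\Lambda)-U_{0,s}(x,\Lambda)\}\le0$, and let $\Lambda_s^*(x)$ be the critical falsification threshold for $\Delta_s(x)$, i.e. the unique root $\Lambda\in(1,\infty)$ of $L_{1,s}(x,\Lambda)=U_{0,s}(x,\Lambda)$. Then $\Lambda_s^*(x)$ simultaneously nullifies $\mathrm{PCRR}_s(x)$ and $\mathrm{PCOR}_s(x)$: the condition $L_{1,s}(x,\Lambda_s^*(x))=U_{0,s}(x,\Lambda_s^*(x))$ ensures that the lower bounds on both ratio scales equal one, $$\frac{L_{1,s}(x,\Lambda_s^*(x))}{U_{0,s}(x,\Lambda_s^*(x))}=1\quad\text{and}\quad\frac{L_{1,s}(x,\Lambda_s^*(x))/\{1-L_{1,s}(x,\Lambda_s^*(x))\}}{U_{0,s}(x,\Lambda_s^*(x))/\{1-U_{0,s}(x,\Lambda_s^*(x))\}}=1.$$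
   Context: Setup. $Z\in\{0,1\}$ is a treatment, $D(z)\in\{0,1\}$ and $Y(z)\in\{0,1\}$ are the potential intermediate and final outcomes under $Z=z$, $X\in\mathcal X$ are baseline covariates and $U$ is a set of unmeasured baseline confounders; neither $X$ nor $U$ is affected by $Z$. Observed: $D=ZD(1)+(1-Z)D(0)$, $Y=ZY(1)+(1-Z)Y(0)$ (SUTVA). The principal stratum is $S=(D(1),D(0))\in\{11,10,01,00\}$. Let $e_s(x)=\mathbb P(S=s\mid X=x)$ and $p_z(x)=\mathbb P(D=1\mid Z=z,X=x)$. Assumptions. Treatment ignorability: $Z\perp\{D(0),D(1),Y(0),Y(1)\}\mid X$. Latent principal ignorability: $Y(z)\perp S\mid X,U$ for $z\in\{0,1\}$. Odds-ratio (non-monotonicity) assumption: there is a known function $\theta:\mathcal X\to[0,\infty]$ with $\theta(x)=e_{11}(x)e_{00}(x)/\{e_{10}(x)e_{01}(x)\}$. Since $p_1=e_{11}+e_{10}$, $p_0=e_{11}+e_{01}$ and $\sum_s e_s=1$, the $e_s(x)$ are then determined by $p_1(x),p_0(x),\theta(x)$. Cells. $\mathcal S_{1,1}=\{10,11\}$, $\mathcal S_{0,0}=\{10,00\}$, $\mathcal S_{1,0}=\{00,01\}$, $\mathcal S_{0,1}=\{11,01\}$. Means, estimands, weights, bounds. $\mu_{z,s}(x)=\mathbb E\{Y(z)\mid S=s,X=x\}$, $m_{z,d}(x)=\mathbb E(Y\mid Z=z,D=d,X=x)$, $\Delta_s(x)=\mu_{1,s}(x)-\mu_{0,s}(x)$,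 $$\mathrm{PCRR}_s(x)=\frac{\mu_{1,s}(x)}{\mu_{0,s}(x)},\qquad\mathrm{PCOR}_s(x)=\frac{\mu_{1,s}(x)/\{1-\mu_{1,s}(x)\}}{\mu_{0,s}(x)/\{1-\mu_{0,s}(x)\}}.$$ For $s\in\mathcal S_{z,d}$: $w_{z,s}(x)=e_s(x)/p_z(x)$ if $d=1$ and $w_{z,s}(x)=e_s(x)/\{1-p_z(x)\}$ if $d=0$. For $b\ge1$ (a common value of the bounding factor) put $A(b)=w_{z,s}(x)+\{1-w_{z,s}(x)\}b$, $B(b)=w_{z,s}(x)+\{1-w_{z,s}(x)\}/b$ and $$L_{z,s}(x,b)=\max\left[\frac{m_{z,d}(x)}{A(b)},\,1-\frac{1-m_{z,d}(x)}{B(b)}\right],\qquad U_{z,s}(x,b)=\min\left[\frac{m_{z,d}(x)}{B(b)},\,1-\frac{1-m_{z,d}(x)}{A(b)}\right].$$ The lower bounds on $\mathrm{PCRR}_s(x)$ and $\mathrm{PCOR}_s(x)$ are $L_{1,s}/U_{0,s}$ and $[L_{1,s}/\{1-L_{1,s}\}]/[U_{0,s}/\{1-U_{0,s}\}]$. *)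

theory Defs
  imports "HOL-Probability.Probability"
begin

definition cond_indep ::
  "'a measure \<Rightarrow> 'a measure \<Rightarrow> 'b measure \<Rightarrow> ('a \<Rightarrow> 'b) \<Rightarrow> 'c measure \<Rightarrow> ('a \<Rightarrow> 'c) \<Rightarrow> bool"
  where
  "cond_indep M F N V N' W \<longleftrightarrow>
     V \<in> measurable M N \<and> W \<in> measurable M N' \<and>
     (\<forall>A\<in>sets N. \<forall>B\<in>sets N'. AE \<omega> in M.
        real_cond_exp M F (indicat_real (V -` A \<inter> W -` B \<inter> space M)) \<omega> =
        real_cond_exp M F (indicat_real (V -` A \<inter> space M)) \<omega> *
        real_cond_exp M F (indicat_real (W -` B \<inter> space M)) \<omega>)"

text \<open>
  Binary values are encoded by \<^typ>\<open>bool\<close>, with \<^const>\<open>True\<close> for 1. A unit is described by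
  its treatment, its potential intermediate outcomes and its potential final outcomes, the last
  two as functions of the treatment level. A stratum is a pair (D(1), D(0)).
\<close>

type_synonym po = "bool \<times> (bool \<Rightarrow> bool) \<times> (bool \<Rightarrow> bool)"
type_synonym stratum = "bool \<times> bool"

definition treat :: "po \<Rightarrow> bool" where
  "treat = (\<lambda>(z, d, y). z)"

definition D_obs :: "po \<Rightarrow> bool" where
  "D_obs = (\<lambda>(z, d, y). if z then d True else d False)"

definition Y_obs :: "po \<Rightarrow> bool" where
  "Y_obs = (\<lambda>(z, d, y). if z then y True else y False)"

definition stratum_of :: "po \<Rightarrow> stratum" where
  "stratum_of = (\<lambda>(z, d, y). (d True, d False))"

text \<open>
  In the following locale \<open>\<kappa> x\<close> is the conditional law, given \<open>X = x\<close>, of the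
  treatment and the potential outcomes: an arbitrary version of the regular conditional
  distribution, which always exists because these variables take finitely many values. All
  conditional probabilities and expectations given \<open>X = x\<close> are computed under \<open>\<kappa> x\<close>;
  further conditioning on an event that is null under \<open>\<kappa> x\<close> gives the value 0.
\<close>

definition e_s :: "('x \<Rightarrow> po pmf) \<Rightarrow> stratum \<Rightarrow> 'x \<Rightarrow> real" where
  "e_s \<kappa> s x = \<P>(w in measure_pmf (\<kappa> x). stratum_of w = s)"

definition p_z :: "('x \<Rightarrow> po pmf) \<Rightarrow> bool \<Rightarrow> 'x \<Rightarrow> real" where
  "p_z \<kappa> z x = \<P>(w in measure_pmf (\<kappa> x). D_obs w \<bar> treat w = z)"

definition m_zd :: "('x \<Rightarrow> po pmf) \<Rightarrow> bool \<Rightarrow> bool \<Rightarrow> 'x \<Rightarrow> real" where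
  "m_zd \<kappa> z d x =
     measure_pmf.expectation (\<kappa> x)
       (\<lambda>w. of_bool (Y_obs w) * indicat_real {w. treat w = z \<and> D_obs w = d} w) /
     \<P>(w in measure_pmf (\<kappa> x). treat w = z \<and> D_obs w = d)"

locale principal_stratification = prob_space M
  for M :: "'a measure" +
  fixes MX :: "'x measure" and MU :: "'u measure"
    and X :: "'a \<Rightarrow> 'x" and U :: "'a \<Rightarrow> 'u"
    and Z :: "'a \<Rightarrow> bool" and D Y :: "bool \<Rightarrow> 'a \<Rightarrow> bool"
    and \<kappa> :: "'x \<Rightarrow> po pmf" and \<theta> :: "'x \<Rightarrow> ennreal"
  assumes X_measurable: "X \<in> measurable M MX"
    and U_measurable: "U \<in> measurable M MU"
    and Z_measurable: "Z \<in> measurable M (count_space UNIV)"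
    and D_measurable: "\<And>z. D z \<in> measurable M (count_space UNIV)"
    and Y_measurable: "\<And>z. Y z \<in> measurable M (count_space UNIV)"
    and kernel_measurable: "\<And>w. (\<lambda>x. pmf (\<kappa> x) w) \<in> borel_measurable MX"
    and kernel: "\<And>w. AE \<omega> in M.
      real_cond_exp M (vimage_algebra (space M) X MX)
        (indicat_real {\<omega> \<in> space M. (Z \<omega>, (\<lambda>z. D z \<omega>), (\<lambda>z. Y z \<omega>)) = w}) \<omega>
      = pmf (\<kappa> (X \<omega>)) w"
    and treatment_ignorability:
      "cond_indep M (vimage_algebra (space M) X MX)
         (count_space UNIV) Z
         (count_space UNIV) (\<lambda>\<omega>. ((\<lambda>z. D z \<omega>), (\<lambda>z. Y z \<omega>)))"
    and latent_principal_ignorability: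
      "\<And>z. cond_indep M (vimage_algebra (space M) (\<lambda>\<omega>. (X \<omega>, U \<omega>)) (MX \<Otimes>\<^sub>M MU))
         (count_space UNIV) (Y z)
         (count_space UNIV) (\<lambda>\<omega>. (D True \<omega>, D False \<omega>))"
    \<comment> \<open>The guard leaves \<open>\<theta> x\<close> unconstrained where the odds ratio is the undefined form 0/0.\<close>
    and odds_ratio:
      "AE x in distr M MX X.
         e_s \<kappa> (True, True) x * e_s \<kappa> (False, False) x \<noteq> 0 \<or>
         e_s \<kappa> (True, False) x * e_s \<kappa> (False, True) x \<noteq> 0 \<longrightarrow>
         \<theta> x = ennreal (e_s \<kappa> (True, True) x * e_s \<kappa> (False, False) x) /
               ennreal (e_s \<kappa> (True, False) x * e_s \<kappa> (False, True) x)"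

fun cell :: "bool \<Rightarrow> bool \<Rightarrow> stratum set" where
  "cell True True = {(True, False), (True, True)}"
| "cell False False = {(True, False), (False, False)}"
| "cell True False = {(False, False), (False, True)}"
| "cell False True = {(True, True), (False, True)}"

definition cell_d :: "bool \<Rightarrow> stratum \<Rightarrow> bool" where
  "cell_d z s = (THE d. s \<in> cell z d)"

lemma cell_iff: "s \<in> cell z d \<longleftrightarrow> (if z then fst s else snd s) = d"
  by (cases s; cases z; cases d) auto

lemma cell_d_eq: "cell_d z s = (if z then fst s else snd s)"
  by (simp add: cell_d_def cell_iff)

definition weight :: "('x \<Rightarrow> po pmf) \<Rightarrow> bool \<Rightarrow> stratum \<Rightarrow> 'x \<Rightarrow> real" where
  "weight \<kappa> z s x =
     (if cell_d z s then e_s \<kappa> s x / p_z \<kappa> z x else e_s \<kappa> s x / (1 - p_z \<kappa> z x))"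

definition A_wt :: "('x \<Rightarrow> po pmf) \<Rightarrow> bool \<Rightarrow> stratum \<Rightarrow> 'x \<Rightarrow> real \<Rightarrow> real" where
  "A_wt \<kappa> z s x b = weight \<kappa> z s x + (1 - weight \<kappa> z s x) * b"

definition B_wt :: "('x \<Rightarrow> po pmf) \<Rightarrow> bool \<Rightarrow> stratum \<Rightarrow> 'x \<Rightarrow> real \<Rightarrow> real" where
  "B_wt \<kappa> z s x b = weight \<kappa> z s x + (1 - weight \<kappa> z s x) / b"

definition lower_bound :: "('x \<Rightarrow> po pmf) \<Rightarrow> bool \<Rightarrow> stratum \<Rightarrow> 'x \<Rightarrow> real \<Rightarrow> real" where
  "lower_bound \<kappa> z s x b =
     max (m_zd \<kappa> z (cell_d z s) x / A_wt \<kappa> z s x b)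
         (1 - (1 - m_zd \<kappa> z (cell_d z s) x) / B_wt \<kappa> z s x b)"

definition upper_bound :: "('x \<Rightarrow> po pmf) \<Rightarrow> bool \<Rightarrow> stratum \<Rightarrow> 'x \<Rightarrow> real \<Rightarrow> real" where
  "upper_bound \<kappa> z s x b =
     min (m_zd \<kappa> z (cell_d z s) x / B_wt \<kappa> z s x b)
         (1 - (1 - m_zd \<kappa> z (cell_d z s) x) / A_wt \<kappa> z s x b)"

text \<open>
  Meaningful only if the two bounds meet at some finite \<open>\<Lambda> > 1\<close>; they do not if their
  difference stays positive and merely tends to 0.
\<close>

definition critical_threshold :: "('x \<Rightarrow> po pmf) \<Rightarrow> stratum \<Rightarrow> 'x \<Rightarrow> real" where
  "critical_threshold \<kappa> s x =
     (THE \<Lambda>. 1 < \<Lambda> \<and> lower_bound \<kappa> True s x \<Lambda> = upper_bound \<kappa> False s x \<Lambda>)"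

definition PCRR_lower :: "('x \<Rightarrow> po pmf) \<Rightarrow> stratum \<Rightarrow> 'x \<Rightarrow> real \<Rightarrow> real" where
  "PCRR_lower \<kappa> s x b = lower_bound \<kappa> True s x b / upper_bound \<kappa> False s x b"

definition PCOR_lower :: "('x \<Rightarrow> po pmf) \<Rightarrow> stratum \<Rightarrow> 'x \<Rightarrow> real \<Rightarrow> real" where
  "PCOR_lower \<kappa> s x b =
     (lower_bound \<kappa> True s x b / (1 - lower_bound \<kappa> True s x b)) /
     (upper_bound \<kappa> False s x b / (1 - upper_bound \<kappa> False s x b))"

end

theory Submission
  imports Defs
begin

text \<open>
  As functions of \<open>\<Lambda> \<ge> 1\<close>, the lower bound is continuous and nonincreasing and the upper bound is
  continuous and nondecreasing, strictly so if the mixture weight is not 1 and the cell mean lies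
  in \<open>(0, 1)\<close>. Their difference is \<open>m\<^sub>1 - m\<^sub>0 > 0\<close> at \<open>\<Lambda> = 1\<close>. It would never vanish if both weights
  were 1 (then it is constant), if \<open>m\<^sub>0 = 0\<close> (upper bound at most 0) or if \<open>m\<^sub>1 = 1\<close> (lower bound at
  least 1), so it is strictly decreasing and has exactly one zero. The common value of the
  bounds there is positive (as is the lower bound) and less than 1 (as is the upper bound), so
  both ratios of equal quantities are genuinely 1. Treatment ignorability is what
  makes the weights \<open>e\<^sub>s/p\<^sub>z\<close> and \<open>e\<^sub>s/(1 - p\<^sub>z)\<close> at most 1.
\<close>

section \<open>The bounds as functions of the bounding factor\<close>

lemma A_wt_ge_1:
  assumes "weight \<kappa> z s x \<le> 1" "1 \<le> b"
  shows "1 \<le> A_wt \<kappa> z s x b"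
proof -
  have "0 \<le> (1 - weight \<kappa> z s x) * (b - 1)"
    using assms by simp
  then show ?thesis
    by (simp add: A_wt_def algebra_simps)
qed

lemma B_wt_pos:
  assumes "weight \<kappa> z s x \<in> {0..1}" "1 \<le> b"
  shows "0 < B_wt \<kappa> z s x b"
\<comment> \<open>At weight 0 the positivity has to come from the other summand,
  \<open>1 / b\<close>.\<close>
proof (cases "weight \<kappa> z s x = 0")
  case False
  then show ?thesis
    using assms by (auto simp: B_wt_def intro: add_pos_nonneg)
qed (use assms in \<open>simp add: B_wt_def\<close>)

lemma A_wt_strict_mono:
  assumes "weight \<kappa> z s x < 1" "b < c"
  shows "A_wt \<kappa> z s x b < A_wt \<kappa> z s x c"
  using assms by (simp add: A_wt_def)

lemma B_wt_strict_antimono: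
  assumes "weight \<kappa> z s x < 1" "0 < b" "b < c"
  shows "B_wt \<kappa> z s x c < B_wt \<kappa> z s x b"
  using assms by (simp add: B_wt_def divide_strict_left_mono)

text \<open>A larger factor raises A and lowers B, so both branches of the maximum fall. A mean
  strictly inside (0, 1) keeps both numerators positive; otherwise one branch would be
  constant.\<close>

lemma lower_bound_strict_antimono:
  assumes "weight \<kappa> z s x \<in> {0..<1}" "m_zd \<kappa> z (cell_d z s) x \<in> {0<..<1}" "1 \<le> b" "b < c"
  shows "lower_bound \<kappa> z s x c < lower_bound \<kappa> z s x b"
proof -
  have "0 < A_wt \<kappa> z s x b'" "0 < B_wt \<kappa> z s x b'" if "1 \<le> b'" for b'
    using A_wt_ge_1[of \<kappa> z s x b'] B_wt_pos[of \<kappa> z s x b'] assms(1) that by auto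
  moreover have "A_wt \<kappa> z s x b < A_wt \<kappa> z s x c" "B_wt \<kappa> z s x c < B_wt \<kappa> z s x b"
    using assms by (auto intro: A_wt_strict_mono B_wt_strict_antimono)
  ultimately have "m_zd \<kappa> z (cell_d z s) x / A_wt \<kappa> z s x c < m_zd \<kappa> z (cell_d z s) x / A_wt \<kappa> z s x b"
    and "(1 - m_zd \<kappa> z (cell_d z s) x) / B_wt \<kappa> z s x b < (1 - m_zd \<kappa> z (cell_d z s) x) / B_wt \<kappa> z s x c"
    using assms by (auto intro!: divide_strict_left_mono mult_pos_pos)
  then show ?thesis
    by (auto simp: lower_bound_def)
qed

lemma upper_bound_strict_mono:
  assumes "weight \<kappa> z s x \<in> {0..<1}" "m_zd \<kappa> z (cell_d z s) x \<in> {0<..<1}" "1 \<le> b" "b < c"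
  shows "upper_bound \<kappa> z s x b < upper_bound \<kappa> z s x c"
proof -
  have "0 < A_wt \<kappa> z s x b'" "0 < B_wt \<kappa> z s x b'" if "1 \<le> b'" for b'
    using A_wt_ge_1[of \<kappa> z s x b'] B_wt_pos[of \<kappa> z s x b'] assms(1) that by auto
  moreover have "A_wt \<kappa> z s x b < A_wt \<kappa> z s x c" "B_wt \<kappa> z s x c < B_wt \<kappa> z s x b"
    using assms by (auto intro: A_wt_strict_mono B_wt_strict_antimono)
  ultimately have "m_zd \<kappa> z (cell_d z s) x / B_wt \<kappa> z s x b < m_zd \<kappa> z (cell_d z s) x / B_wt \<kappa> z s x c"
    and "(1 - m_zd \<kappa> z (cell_d z s) x) / A_wt \<kappa> z s x c < (1 - m_zd \<kappa> z (cell_d z s) x) / A_wt \<kappa> z s x b"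
    using assms by (auto intro!: divide_strict_left_mono mult_pos_pos)
  then show ?thesis
    by (auto simp: upper_bound_def)
qed

text \<open>Here A = B = 1 for every factor: this is the case in which strict monotonicity
  fails.\<close>

lemma bounds_weight_1:
  assumes "weight \<kappa> z s x = 1"
  shows "lower_bound \<kappa> z s x b = m_zd \<kappa> z (cell_d z s) x"
    and "upper_bound \<kappa> z s x b = m_zd \<kappa> z (cell_d z s) x"
  using assms by (simp_all add: lower_bound_def upper_bound_def A_wt_def B_wt_def)

lemma bounds_at_1:
  shows "lower_bound \<kappa> z s x 1 = m_zd \<kappa> z (cell_d z s) x"
    and "upper_bound \<kappa> z s x 1 = m_zd \<kappa> z (cell_d z s) x"
  by (simp_all add: lower_bound_def upper_bound_def A_wt_def B_wt_def)

lemma continuous_on_bounds: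
  assumes "weight \<kappa> z s x \<in> {0..1}"
  shows "continuous_on {1..} (lower_bound \<kappa> z s x)"
    and "continuous_on {1..} (upper_bound \<kappa> z s x)"
proof -
  have "continuous_on {1..} (A_wt \<kappa> z s x)" "continuous_on {1..} (B_wt \<kappa> z s x)"
    unfolding A_wt_def B_wt_def by (auto intro!: continuous_intros)
  moreover have "A_wt \<kappa> z s x b \<noteq> 0" "B_wt \<kappa> z s x b \<noteq> 0" if "1 \<le> b" for b
    using A_wt_ge_1[of \<kappa> z s x b] B_wt_pos[of \<kappa> z s x b] assms that by auto
  ultimately show "continuous_on {1..} (lower_bound \<kappa> z s x)"
    and "continuous_on {1..} (upper_bound \<kappa> z s x)"
    unfolding lower_bound_def upper_bound_def by (auto intro!: continuous_intros)
qed

text \<open>The branch m/A alone suffices. With \<open>upper_bound_less_1\<close> this puts the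
  common value at the root inside (0, 1), where neither ratio is decided by the convention x/0 =
  0.\<close>

lemma lower_bound_pos:
  assumes "weight \<kappa> z s x \<le> 1" "0 < m_zd \<kappa> z (cell_d z s) x" "1 \<le> b"
  shows "0 < lower_bound \<kappa> z s x b"
  using A_wt_ge_1[OF assms(1,3)] assms(2) by (auto simp: lower_bound_def less_max_iff_disj)

lemma upper_bound_less_1:
  assumes "weight \<kappa> z s x \<le> 1" "m_zd \<kappa> z (cell_d z s) x < 1" "1 \<le> b"
  shows "upper_bound \<kappa> z s x b < 1"
  using A_wt_ge_1[OF assms(1,3)] assms(2) by (auto simp: upper_bound_def min_less_iff_disj)

text \<open>The numerator is the mass of a subset of the conditioning event. If that event is null,
  the quotient is 0 by convention, which is still in range.\<close>

lemma m_zd_bounds: "m_zd \<kappa> z d x \<in> {0..1}"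
proof -
  let ?E = "{w. treat w = z \<and> D_obs w = d}"
  have "(\<integral>w. of_bool (Y_obs w) * indicat_real ?E w \<partial>measure_pmf (\<kappa> x)) =
        (\<integral>w. indicat_real ({w. Y_obs w} \<inter> ?E) w \<partial>measure_pmf (\<kappa> x))"
    by (intro Bochner_Integration.integral_cong) (auto simp: indicator_def)
  also have "\<dots> = measure (\<kappa> x) ({w. Y_obs w} \<inter> ?E)"
    by simp
  finally have "m_zd \<kappa> z d x = measure (\<kappa> x) ({w. Y_obs w} \<inter> ?E) / measure (\<kappa> x) ?E"
    by (simp add: m_zd_def)
  moreover have "measure (\<kappa> x) ({w. Y_obs w} \<inter> ?E) \<le> measure (\<kappa> x) ?E"
    by (intro measure_pmf.finite_measure_mono) auto
  ultimately show ?thesis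
    by (auto simp: divide_le_eq_1 zero_less_measure_iff)
qed

text \<open>The analytic core at a fixed \<open>x\<close>. A limit \<open>l < 0\<close> forces a
  root by the intermediate value theorem, whereas \<open>l = 0\<close> allows a difference that
  stays positive, so there a root is assumed.\<close>

lemma critical_threshold_nullifies:
  assumes w: "\<And>z. weight \<kappa> z s x \<in> {0..1}"
    and m_less: "m_zd \<kappa> False (cell_d False s) x < m_zd \<kappa> True (cell_d True s) x"
    and lim: "((\<lambda>\<Lambda>. lower_bound \<kappa> True s x \<Lambda> - upper_bound \<kappa> False s x \<Lambda>) \<longlongrightarrow> l) at_top"
    and l: "l \<le> 0"
      "l = 0 \<Longrightarrow> \<exists>\<Lambda>>1. lower_bound \<kappa> True s x \<Lambda> = upper_bound \<kappa> False s x \<Lambda>"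
  shows "PCRR_lower \<kappa> s x (critical_threshold \<kappa> s x) = 1"
    and "PCOR_lower \<kappa> s x (critical_threshold \<kappa> s x) = 1"
proof -
  define f where "f \<Lambda> = lower_bound \<kappa> True s x \<Lambda> - upper_bound \<kappa> False s x \<Lambda>" for \<Lambda>
  let ?m1 = "m_zd \<kappa> True (cell_d True s) x" and ?m0 = "m_zd \<kappa> False (cell_d False s) x"
  have m01: "0 \<le> ?m0" "?m1 \<le> 1"
    using m_zd_bounds[of \<kappa> False "cell_d False s" x] m_zd_bounds[of \<kappa> True "cell_d True s" x]
    by auto
  have L_pos: "0 < lower_bound \<kappa> True s x b" and U_less: "upper_bound \<kappa> False s x b < 1"
    if "1 \<le> b" for b
    using w[of True] w[of False] m_less m01 that by (auto intro: lower_bound_pos upper_bound_less_1)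
  have f1: "f 1 = ?m1 - ?m0"
    by (simp add: f_def bounds_at_1)
  have cont: "continuous_on {1..} f"
    unfolding f_def using w by (intro continuous_intros continuous_on_bounds)

  have root: "\<exists>\<Lambda>>1. f \<Lambda> = 0"
  proof (cases "l = 0")
    case True
    then show ?thesis using l by (simp add: f_def)
  next
    case False
    then have "\<forall>\<^sub>F \<Lambda> in at_top. f \<Lambda> < 0"
      using order_tendstoD(2)[OF lim, of 0] l by (simp add: f_def)
    then have "\<forall>\<^sub>F \<Lambda> in at_top. f \<Lambda> < 0 \<and> 1 < \<Lambda>"
      using eventually_gt_at_top by (rule eventually_conj)
    then obtain N where N: "f N < 0" "1 < N"
      by (auto dest: eventually_happens)
    have "\<exists>\<Lambda>\<ge>1. \<Lambda> \<le> N \<and> f \<Lambda> = 0"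
      using N f1 m_less cont by (intro IVT2') (auto elim: continuous_on_subset)
    \<comment> \<open>The value at 1 is positive, so the root found in [1, N] is not 1
      itself.\<close>
    then show ?thesis
      using f1 m_less by (metis diff_gt_0_iff_gt less_le)
  qed
  then obtain R where R: "1 < R" "f R = 0" by blast

  \<comment> \<open>Degenerate means are excluded by evaluating the bounds at \<open>R\<close>, so
    existence of the root has to precede strict monotonicity.\<close>
  have "?m0 \<noteq> 0"
  proof
    assume "?m0 = 0"
    then have "upper_bound \<kappa> False s x R \<le> 0"
      by (auto simp: upper_bound_def min_le_iff_disj)
    then show False using R L_pos[of R] by (simp add: f_def)
  qed
  moreover have "?m1 \<noteq> 1"
  proof
    assume "?m1 = 1"
    then have "1 \<le> lower_bound \<kappa> True s x R"
      by (auto simp: lower_bound_def le_max_iff_disj)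
    then show False using R U_less[of R] by (simp add: f_def)
  qed
  ultimately have m: "?m1 \<in> {0<..<1}" "?m0 \<in> {0<..<1}"
    using m01 m_less by auto

  have not_both: "\<not> (weight \<kappa> True s x = 1 \<and> weight \<kappa> False s x = 1)"
    using R m_less by (auto simp: f_def bounds_weight_1)
  \<comment> \<open>One strictly monotone bound is enough; the other may be constant because its
    weight is 1.\<close>
  have f_less: "f c < f b" if bc: "1 \<le> b" "b < c" for b c
  proof -
    have L: "weight \<kappa> True s x \<noteq> 1 \<Longrightarrow> lower_bound \<kappa> True s x c < lower_bound \<kappa> True s x b"
      using lower_bound_strict_antimono[of \<kappa> True s x b c] w[of True] m bc by auto
    have U: "weight \<kappa> False s x \<noteq> 1 \<Longrightarrow> upper_bound \<kappa> False s x b < upper_bound \<kappa> False s x c"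
      using upper_bound_strict_mono[of \<kappa> False s x b c] w[of False] m bc by auto
    have "lower_bound \<kappa> True s x c \<le> lower_bound \<kappa> True s x b"
      by (cases "weight \<kappa> True s x = 1") (use L in \<open>auto simp: bounds_weight_1\<close>)
    moreover have "upper_bound \<kappa> False s x b \<le> upper_bound \<kappa> False s x c"
      by (cases "weight \<kappa> False s x = 1") (use U in \<open>auto simp: bounds_weight_1\<close>)
    ultimately show ?thesis
      using L U not_both by (fastforce simp: f_def)
  qed
  have "critical_threshold \<kappa> s x = R"
    unfolding critical_threshold_def
  proof (rule the_equality)
    fix \<Lambda> assume "1 < \<Lambda> \<and> lower_bound \<kappa> True s x \<Lambda> = upper_bound \<kappa> False s x \<Lambda>"
    then show "\<Lambda> = R"
      using f_less[of \<Lambda> R] f_less[of R \<Lambda>] R by (force simp: f_def)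
  qed (use R in \<open>simp add: f_def\<close>)
  then show "PCRR_lower \<kappa> s x (critical_threshold \<kappa> s x) = 1"
    and "PCOR_lower \<kappa> s x (critical_threshold \<kappa> s x) = 1"
    using R L_pos[of R] U_less[of R] by (simp_all add: PCRR_lower_def PCOR_lower_def f_def)
qed

section \<open>Treatment ignorability and the mixture weights\<close>

text \<open>Independence turns p_z into the mass of D(z) = 1, and the stratum lies inside that event
  or inside its complement, according to its cell.\<close>

lemma weight_in_unit_interval:
  fixes \<kappa> :: "'x \<Rightarrow> po pmf"
  assumes indep: "measure (\<kappa> x) {w. treat w = z \<and> fst (snd w) z} =
    measure (\<kappa> x) {w. treat w = z} * measure (\<kappa> x) {w. fst (snd w) z}"
  shows "weight \<kappa> z s x \<in> {0..1}"
proof -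
  let ?P = "measure (\<kappa> x)" and ?D = "{w :: po. fst (snd w) z}"
  have "D_obs w \<and> treat w = z \<longleftrightarrow> treat w = z \<and> fst (snd w) z" for w
    by (cases w) (auto simp: D_obs_def treat_def)
  then have "p_z \<kappa> z x = ?P {w. treat w = z \<and> fst (snd w) z} / ?P {w. treat w = z}"
    by (simp add: p_z_def cond_prob_def)
  \<comment> \<open>The second alternative is a null treatment arm, where conditioning gives 0. The
    weight is then 0 or \<open>e_s\<close> itself, both in [0, 1].\<close>
  then have p: "p_z \<kappa> z x = ?P ?D \<or> p_z \<kappa> z x = 0"
    by (simp add: indep)
  have e: "e_s \<kappa> s x = ?P {w. stratum_of w = s}"
    by (simp add: e_s_def)
  have e1: "0 \<le> e_s \<kappa> s x" "e_s \<kappa> s x \<le> 1"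
    by (auto simp: e)
  show ?thesis
  proof (cases "cell_d z s")
    case True
    then have "{w. stratum_of w = s} \<subseteq> ?D"
      by (cases z) (auto simp: stratum_of_def cell_d_eq)
    then have "e_s \<kappa> s x \<le> ?P ?D"
      by (simp add: e measure_pmf.finite_measure_mono)
    then show ?thesis
      using p e1 True by (auto simp: weight_def divide_le_eq_1)
  next
    case False
    then have "{w. stratum_of w = s} \<subseteq> UNIV - ?D"
      by (cases z) (auto simp: stratum_of_def cell_d_eq)
    then have "e_s \<kappa> s x \<le> ?P (UNIV - ?D)"
      by (simp add: e measure_pmf.finite_measure_mono)
    also have "\<dots> = 1 - ?P ?D"
      using measure_pmf.prob_compl[of ?D "\<kappa> x"] by simp
    finally show ?thesis
      using p e1 False by (auto simp: weight_def divide_le_eq_1)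
  qed
qed

section \<open>From conditional expectations on the sample space to the kernel\<close>

context principal_stratification
begin

abbreviation "T \<omega> \<equiv> (Z \<omega>, (\<lambda>z. D z \<omega>), (\<lambda>z. Y z \<omega>))"
abbreviation "FX \<equiv> vimage_algebra (space M) X MX"

lemma T_sets: "{\<omega> \<in> space M. T \<omega> = w} \<in> sets M"
proof -
  obtain a d y where w: "w = (a, d, y)" by (cases w) auto
  have "{\<omega> \<in> space M. T \<omega> = w} =
    {\<omega> \<in> space M. Z \<omega> = a \<and> (\<forall>z. D z \<omega> = d z) \<and> (\<forall>z. Y z \<omega> = y z)}"
    by (auto simp: w)
  also have "\<dots> \<in> sets M"
    using Z_measurable D_measurable Y_measurable by measurable
  finally show ?thesis .
qed

text \<open>\<open>T\<close> takes finitely many values, so the kernel property for points extends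
  to events by linearity, at the cost of finitely many null sets.\<close>

lemma cond_exp_event:
  "AE \<omega> in M. real_cond_exp M FX (indicat_real {\<omega> \<in> space M. T \<omega> \<in> S}) \<omega> = measure (\<kappa> (X \<omega>)) S"
proof -
  have "subalgebra M FX"
    using X_measurable by (auto simp: subalgebra_def sets_vimage_algebra2 measurable_space
        intro: measurable_sets)
  then interpret finite_measure_subalgebra M FX
    by unfold_locales
  let ?I = "\<lambda>w. indicat_real {\<omega> \<in> space M. T \<omega> = w}"
  have "indicat_real {\<omega> \<in> space M. T \<omega> \<in> S} = (\<lambda>\<omega>. \<Sum>w\<in>S. ?I w \<omega>)"
    by (auto simp: indicator_def fun_eq_iff)
  moreover have "AE \<omega> in M. real_cond_exp M FX (\<lambda>\<omega>. \<Sum>w\<in>S. ?I w \<omega>) \<omega> =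
      (\<Sum>w\<in>S. real_cond_exp M FX (?I w) \<omega>)"
    using T_sets by (intro real_cond_exp_sum integrable_real_indicator) (auto simp: emeasure_eq_measure)
  moreover have "AE \<omega> in M. \<forall>w\<in>S. real_cond_exp M FX (?I w) \<omega> = pmf (\<kappa> (X \<omega>)) w"
    using kernel by (intro AE_finite_allI) auto
  ultimately show ?thesis
    by (auto simp: measure_measure_pmf_finite)
qed

lemma AE_treatment_indep:
  "AE x in distr M MX X. measure (\<kappa> x) {w. treat w = z \<and> fst (snd w) z} =
     measure (\<kappa> x) {w. treat w = z} * measure (\<kappa> x) {w. fst (snd w) z}"
proof -
  \<comment> \<open>The event D(z) = 1, read as a set of values of the joint potential outcomes to
    which ignorability applies.\<close>
  let ?B = "{(d, y). d z} :: ((bool \<Rightarrow> bool) \<times> (bool \<Rightarrow> bool)) set"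
  have eqs: "{\<omega> \<in> space M. T \<omega> \<in> {w. treat w = z \<and> fst (snd w) z}} =
      Z -` {z} \<inter> (\<lambda>\<omega>. ((\<lambda>z. D z \<omega>), (\<lambda>z. Y z \<omega>))) -` ?B \<inter> space M"
    "{\<omega> \<in> space M. T \<omega> \<in> {w. treat w = z}} = Z -` {z} \<inter> space M"
    "{\<omega> \<in> space M. T \<omega> \<in> {w. fst (snd w) z}} =
      (\<lambda>\<omega>. ((\<lambda>z. D z \<omega>), (\<lambda>z. Y z \<omega>))) -` ?B \<inter> space M"
    by (auto simp: treat_def)
  have "AE \<omega> in M.
     real_cond_exp M FX (indicat_real {\<omega> \<in> space M. T \<omega> \<in> {w. treat w = z \<and> fst (snd w) z}}) \<omega> =
     real_cond_exp M FX (indicat_real {\<omega> \<in> space M. T \<omega> \<in> {w. treat w = z}}) \<omega> *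
     real_cond_exp M FX (indicat_real {\<omega> \<in> space M. T \<omega> \<in> {w. fst (snd w) z}}) \<omega>"
    using treatment_ignorability unfolding cond_indep_def sets_count_space Pow_UNIV eqs by blast
  then have "AE \<omega> in M. measure (\<kappa> (X \<omega>)) {w. treat w = z \<and> fst (snd w) z} =
     measure (\<kappa> (X \<omega>)) {w. treat w = z} * measure (\<kappa> (X \<omega>)) {w. fst (snd w) z}"
    using cond_exp_event[of "{w. treat w = z \<and> fst (snd w) z}"]
      cond_exp_event[of "{w. treat w = z}"] cond_exp_event[of "{w. fst (snd w) z}"]
    by eventually_elim simp
  \<comment> \<open>Measurability in \<open>x\<close> makes the set where the equation holds
    measurable, so the statement passes from \<open>M\<close> to the law of
    \<open>X\<close>.\<close>
  moreover have "(\<lambda>x. measure (\<kappa> x) S) \<in> borel_measurable MX" for S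
    using kernel_measurable by (simp add: measure_measure_pmf_finite)
  ultimately show ?thesis
    using X_measurable
    by (subst AE_distr_iff) (auto intro!: borel_measurable_eq borel_measurable_times)
qed

end

theorem corollary5:
  fixes M :: "'a measure" and MX :: "'x measure" and MU :: "'u measure"
    and X :: "'a \<Rightarrow> 'x" and U :: "'a \<Rightarrow> 'u"
    and Z :: "'a \<Rightarrow> bool" and D Y :: "bool \<Rightarrow> 'a \<Rightarrow> bool"
    and \<kappa> :: "'x \<Rightarrow> po pmf" and \<theta> :: "'x \<Rightarrow> ennreal"
    and s :: stratum
  assumes "principal_stratification M MX MU X U Z D Y \<kappa> \<theta>"
  shows "AE x in distr M MX X. \<forall>l :: real.
    m_zd \<kappa> True (cell_d True s) x - m_zd \<kappa> False (cell_d False s) x > 0 \<longrightarrow>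
    ((\<lambda>\<Lambda>. lower_bound \<kappa> True s x \<Lambda> - upper_bound \<kappa> False s x \<Lambda>) \<longlongrightarrow> l) at_top \<longrightarrow>
    l \<le> 0 \<longrightarrow>
    (l = 0 \<longrightarrow> (\<exists>\<Lambda>>1. lower_bound \<kappa> True s x \<Lambda> = upper_bound \<kappa> False s x \<Lambda>)) \<longrightarrow>
    PCRR_lower \<kappa> s x (critical_threshold \<kappa> s x) = 1 \<and>
    PCOR_lower \<kappa> s x (critical_threshold \<kappa> s x) = 1"
proof -
  interpret principal_stratification M MX MU X U Z D Y \<kappa> \<theta>
    by fact
  \<comment> \<open>The exceptional null sets come from independence in the two arms only and do not
    depend on \<open>l\<close>, so one null set serves all limits.\<close>
  show ?thesis
    using AE_treatment_indep[of True] AE_treatment_indep[of False]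
  proof eventually_elim
    case (elim x)
    have "weight \<kappa> z s x \<in> {0..1}" for z
      using elim by (cases z) (simp_all only: weight_in_unit_interval)
    then show ?case
      using critical_threshold_nullifies[of \<kappa> s x] by auto
  qed
qed

end
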